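(* Let $f:\mathcal{H}\to\mathcal{H}'$ be an embedding of linear Heyting algebras. Then $f$ is a $\forall$-embedding if and only if it is cover-preserving.
   Context: A linear Heyting algebra is a Heyting algebra (in the language $\wedge,\vee,\to,0,1$) whose lattice reduct is a linear order. An embedding is an injective Heyting algebra homomorphism. In a partial order, $a\prec b$ ($b$ covers $a$) means $a<b$ and whenever $a<c$ then $b\le c$. An embedding $f$ is cover-preserving if $a\prec b$ implies $f(a)\prec f(b)$. An embedding $f:\mathcal{A}\to\mathcal{B}$ is a $\forall$-embedding if for every equation $\phi(\overline x,\overline y)$ and tuple $\overline a$ in $A$, $\mathcal{A}\vDash\forall\overline x\phi(\overline x,\overline a)$ implies $\mathcal{B}\vDash\forall\overline x\phi(\overline x,f\overline a)$. *)

theory Defs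
  imports Main
begin

class heyting_algebra = bounded_lattice +
  fixes heyting_imp :: "'a \<Rightarrow> 'a \<Rightarrow> 'a"  (infixr "\<rightarrow>\<^sub>H" 60)
  assumes heyting_residuation: "inf c a \<le> b \<longleftrightarrow> c \<le> a \<rightarrow>\<^sub>H b"

class linear_heyting_algebra = heyting_algebra + linorder

definition heyting_hom :: "('a::heyting_algebra \<Rightarrow> 'b::heyting_algebra) \<Rightarrow> bool" where
  "heyting_hom f \<longleftrightarrow>
     (\<forall>a b. f (inf a b) = inf (f a) (f b)) \<and>
     (\<forall>a b. f (sup a b) = sup (f a) (f b)) \<and>
     (\<forall>a b. f (a \<rightarrow>\<^sub>H b) = f a \<rightarrow>\<^sub>H f b) \<and>
     f bot = bot \<and> f top = top"

definition heyting_embedding :: "('a::heyting_algebra \<Rightarrow> 'b::heyting_algebra) \<Rightarrow> bool" where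
  "heyting_embedding f \<longleftrightarrow> heyting_hom f \<and> inj f"

definition covered_by :: "'a::order \<Rightarrow> 'a \<Rightarrow> bool"  (infix "\<prec>" 50) where
  "a \<prec> b \<longleftrightarrow> a < b \<and> (\<forall>c. a < c \<longrightarrow> b \<le> c)"

definition cover_preserving :: "('a::order \<Rightarrow> 'b::order) \<Rightarrow> bool" where
  "cover_preserving f \<longleftrightarrow> (\<forall>a b. a \<prec> b \<longrightarrow> f a \<prec> f b)"

datatype 'v hterm =
    HVar 'v
  | HBot
  | HTop
  | HAnd "'v hterm" "'v hterm"
  | HOr "'v hterm" "'v hterm"
  | HImp "'v hterm" "'v hterm"

primrec hterm_eval :: "('v \<Rightarrow> 'a::heyting_algebra) \<Rightarrow> 'v hterm \<Rightarrow> 'a" where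
  "hterm_eval e (HVar v) = e v"
| "hterm_eval e HBot = bot"
| "hterm_eval e HTop = top"
| "hterm_eval e (HAnd s t) = inf (hterm_eval e s) (hterm_eval e t)"
| "hterm_eval e (HOr s t) = sup (hterm_eval e s) (hterm_eval e t)"
| "hterm_eval e (HImp s t) = hterm_eval e s \<rightarrow>\<^sub>H hterm_eval e t"

text \<open>
  The equation \<open>s = t\<close> in the variables \<open>x\<^sub>0, \<dots>, x\<^sub>m\<^sub>-\<^sub>1, y\<^sub>0, \<dots>, y\<^sub>n\<^sub>-\<^sub>1\<close>, where
  \<open>x\<^sub>i\<close> is \<open>HVar (Inl i)\<close> and \<open>y\<^sub>j\<close> is \<open>HVar (Inr j)\<close>.
\<close>

definition equation_in :: "nat \<Rightarrow> nat \<Rightarrow> (nat + nat) hterm \<Rightarrow> (nat + nat) hterm \<Rightarrow> bool" where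
  "equation_in m n s t \<longleftrightarrow>
     set_hterm s \<subseteq> {..<m} <+> {..<n} \<and> set_hterm t \<subseteq> {..<m} <+> {..<n}"

definition satisfies_eq ::
    "(nat + nat) hterm \<Rightarrow> (nat + nat) hterm \<Rightarrow> 'a::heyting_algebra list \<Rightarrow> 'a list \<Rightarrow> bool" where
  "satisfies_eq s t xs ys \<longleftrightarrow>
     hterm_eval (case_sum ((!) xs) ((!) ys)) s = hterm_eval (case_sum ((!) xs) ((!) ys)) t"

definition forall_embedding :: "('a::heyting_algebra \<Rightarrow> 'b::heyting_algebra) \<Rightarrow> bool" where
  "forall_embedding f \<longleftrightarrow> heyting_embedding f \<and>
     (\<forall>m n s t (as :: 'a list). equation_in m n s t \<longrightarrow> length as = n \<longrightarrow>
        (\<forall>xs :: 'a list. length xs = m \<longrightarrow> satisfies_eq s t xs as) \<longrightarrow>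
        (\<forall>xs :: 'b list. length xs = m \<longrightarrow> satisfies_eq s t xs (map f as)))"

end

theory Submission
  imports Defs
begin

text \<open>
  In a linear Heyting algebra \<open>a \<rightarrow> b\<close> is \<open>1\<close> if \<open>a \<le> b\<close> and \<open>b\<close> otherwise, so every strictly
  monotone map between subsets containing \<open>0\<close> and \<open>1\<close> that fixes them commutes with all terms.
  If \<open>a \<prec> b\<close>, then \<open>(x \<rightarrow> a) \<or> (b \<rightarrow> x) = 1\<close> holds for all \<open>x\<close>; any \<open>x\<close> strictly between
  \<open>f a\<close> and \<open>f b\<close> would refute its image under \<open>f\<close>.
  Conversely, a refutation in the larger algebra involves finitely many elements, and it can be
  pulled back along a strictly monotone map that inverts \<open>f\<close> on the parameters. This map is built
  separately on each gap \<open>(f a, f b)\<close> between consecutive parameters: if \<open>(a, b)\<close> is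
  infinite, there is room for any finite chain, and if it is finite, then, covers being preserved,
  all elements of \<open>(f a, f b)\<close> are already in the image of \<open>f\<close>.
\<close>

section \<open>Operations and terms over a linear order\<close>

lemma heyting_imp_linear:
  fixes a b :: "'a::linear_heyting_algebra"
  shows "a \<rightarrow>\<^sub>H b = (if a \<le> b then top else b)"
proof (cases "a \<le> b")
  case True
  then have "top \<le> a \<rightarrow>\<^sub>H b"
    using heyting_residuation[of top a b] by simp
  with True show ?thesis by (simp add: top_unique)
next
  case False
  \<comment> \<open>On a chain this infimum is one of its two arguments, and it cannot be
    \<open>a\<close>, since \<open>a \<le> b\<close> fails.\<close>
  have "inf (a \<rightarrow>\<^sub>H b) a \<le> b" by (simp add: heyting_residuation)
  with False have "a \<rightarrow>\<^sub>H b \<le> b"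
    by (cases "a \<rightarrow>\<^sub>H b \<le> a") (auto simp: inf_absorb1 inf_absorb2)
  moreover have "b \<le> a \<rightarrow>\<^sub>H b"
    by (simp flip: heyting_residuation)
  ultimately show ?thesis using False by auto
qed

lemma sup_eq_top_linear:
  fixes a b :: "'a::linear_heyting_algebra"
  shows "sup a b = top \<longleftrightarrow> a = top \<or> b = top"
  by (cases "a \<le> b") (auto simp: sup_absorb1 sup_absorb2 top_unique)

lemma heyting_imp_eq_top: "a \<rightarrow>\<^sub>H b = top \<longleftrightarrow> a \<le> b" for a b :: "'a::heyting_algebra"
  using heyting_residuation[of top a b] by (simp add: top_unique)

lemma heyting_embedding_strict_mono:
  fixes f :: "'a::heyting_algebra \<Rightarrow> 'b::heyting_algebra"
  assumes "heyting_embedding f"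
  shows "strict_mono f"
proof (rule strict_monoI)
  fix x y :: 'a
  assume "x < y"
  then have "f x = inf (f x) (f y)" "f x \<noteq> f y"
    using assms unfolding heyting_embedding_def heyting_hom_def
    by (metis inf.strict_order_iff, metis inj_eq less_irrefl)
  then show "f x < f y" by (simp add: inf.strict_order_iff)
qed

text \<open>Each operation returns one of its arguments or \<open>top\<close>, so any
  \<open>C\<close> containing the two constants is closed. Which of these it returns depends only on
  comparisons, and \<open>g\<close> both preserves and reflects the order on
  \<open>C\<close>.\<close>

lemma hterm_eval_strict_mono_on:
  fixes g :: "'b::linear_heyting_algebra \<Rightarrow> 'a::linear_heyting_algebra"
  assumes g: "strict_mono_on C g" and C: "bot \<in> C" "top \<in> C" "g bot = bot" "g top = top"
    and e: "\<And>v. v \<in> set_hterm t \<Longrightarrow> e v \<in> C \<and> e' v = g (e v)"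
  shows "hterm_eval e t \<in> C \<and> hterm_eval e' t = g (hterm_eval e t)"
proof -
  have le: "g x \<le> g y \<longleftrightarrow> x \<le> y" if "x \<in> C" "y \<in> C" for x y
    using strict_mono_on_less_eq[OF g] that by blast
  have inf: "inf x y \<in> C \<and> inf (g x) (g y) = g (inf x y)"
    and sup: "sup x y \<in> C \<and> sup (g x) (g y) = g (sup x y)"
    and imp: "x \<rightarrow>\<^sub>H y \<in> C \<and> g x \<rightarrow>\<^sub>H g y = g (x \<rightarrow>\<^sub>H y)"
    if "x \<in> C" "y \<in> C" for x y
    using that C le[OF that] le[OF that(2,1)]
    by (cases "x \<le> y"; simp add: inf_absorb1 inf_absorb2 sup_absorb1 sup_absorb2
        heyting_imp_linear)+
  show ?thesis
    using e by (induction t) (use inf sup imp C in simp_all)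
qed

section \<open>Pulling finite sets back along a cover-preserving map\<close>

lemma ex_strict_mono_on_finite:
  fixes D :: "'b::linorder set" and T :: "'a::linorder set"
  assumes "finite D" "infinite T"
  shows "\<exists>h. strict_mono_on D h \<and> h ` D \<subseteq> T"
proof -
  \<comment> \<open>For equal finite cardinalities, the induction pairs the maximum of
    \<open>D\<close> with that of \<open>T\<close>. It therefore needs arbitrary \<open>T\<close>,
    as \<open>Max T\<close> is removed.\<close>
  have "\<exists>h. strict_mono_on D h \<and> h ` D \<subseteq> T" if "finite T" "card T = card D" for T :: "'a set"
    using assms(1) that
  proof (induction D arbitrary: T rule: finite_linorder_max_induct)
    case empty
    then show ?case by (auto simp: strict_mono_on_def)
  next
    case (insert b A)
    then have "card T = Suc (card A)" by (metis card_insert_disjoint less_irrefl)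
    then have T: "Max T \<in> T" using insert.prems(1) by (metis Max_in card.empty nat.distinct(1))
    then have "card (T - {Max T}) = card A"
      using \<open>card T = Suc (card A)\<close> insert.prems(1) by simp
    then obtain h where h: "strict_mono_on A h" "h ` A \<subseteq> T - {Max T}"
      using insert.IH[of "T - {Max T}"] insert.prems(1) by auto
    have "h x < Max T" if "x \<in> A" for x
      using h(2) that insert.prems(1) by (metis Diff_iff Max_ge image_subset_iff insertCI order_le_neq_trans)
    then have "strict_mono_on (insert b A) (h(b := Max T))"
      using h(1) insert.hyps(2) by (auto simp: strict_mono_on_def dest: less_asym)
    moreover have "(h(b := Max T)) ` insert b A \<subseteq> T"
      using h(2) T by auto
    ultimately show ?case by blast
  qed
  moreover obtain T' where "T' \<subseteq> T" "finite T'" "card T' = card D"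
    using assms(2) infinite_arbitrarily_large by blast
  ultimately show ?thesis by (meson subset_trans)
qed

text \<open>Finiteness yields a last point \<open>a'\<close> before \<open>b\<close> with
  \<open>f a' \<le> z\<close>, and a successor \<open>b'\<close> of \<open>a'\<close>. As
  \<open>f b'\<close> covers \<open>f a'\<close>, having \<open>f a' < z\<close> would give
  \<open>f b' \<le> z\<close>; then \<open>b'\<close> is not \<open>b\<close>, and this contradicts
  the choice of \<open>a'\<close>.\<close>

lemma cover_preserving_finite_gap:
  fixes f :: "'a::linorder \<Rightarrow> 'b::linorder"
  assumes "strict_mono f" "cover_preserving f" "finite {a<..<b}" and z: "f a < z" "z < f b"
  shows "\<exists>c \<in> {a<..<b}. z = f c"
proof -
  have ab: "a < b" using assms(1) z by (meson less_trans strict_mono_less)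
  then have "{a..<b} = insert a {a<..<b}" "{a<..b} = insert b {a<..<b}" by auto
  with assms(3) have fin: "finite {a..<b}" "finite {a<..b}" by simp_all
  define L where "L = {c \<in> {a..<b}. f c \<le> z}"
  define a' where "a' = Max L"
  have "finite L" by (rule finite_subset[OF _ fin(1)]) (auto simp: L_def)
  moreover have "a \<in> L" using ab z by (auto simp: L_def)
  ultimately have L: "finite L" "a \<in> L" by blast+
  then have "a' \<in> L" using Max_in a'_def by blast
  then have a': "a \<le> a'" "a' < b" "f a' \<le> z" by (auto simp: L_def)
  define b' where "b' = Min {a'<..b}"
  have fin': "finite {a'<..b}"
    by (rule finite_subset[OF _ fin(2)]) (use a' in auto)
  then have "b' \<in> {a'<..b}" using a' Min_in[of "{a'<..b}"] b'_def by auto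
  then have b': "a' < b'" "b' \<le> b" by auto
  have "b' \<le> c" if "a' < c" for c
    using that fin' b' by (cases "c \<le> b") (auto simp: b'_def)
  with b' have "a' \<prec> b'" by (auto simp: covered_by_def)
  then have cov: "f a' \<prec> f b'" using assms(2) by (simp add: cover_preserving_def)
  have "f a' = z"
  proof (rule ccontr)
    assume "f a' \<noteq> z"
    with a' cov have "f b' \<le> z" by (simp add: covered_by_def)
    moreover from this z(2) have "b' \<noteq> b" by auto
    ultimately have "b' \<in> L" using b' a' by (auto simp: L_def)
    then have "b' \<le> a'" using L(1) by (simp add: a'_def)
    with b' show False by simp
  qed
  moreover have "a \<noteq> a'" using z \<open>f a' = z\<close> by auto
  ultimately show ?thesis using a' by auto
qed

lemma cover_preserving_gap_pullback:
  fixes f :: "'a::linorder \<Rightarrow> 'b::linorder"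
  assumes "strict_mono f" "cover_preserving f" "finite D"
  shows "\<exists>h. strict_mono_on (D \<inter> {f a<..<f b}) h \<and> h ` (D \<inter> {f a<..<f b}) \<subseteq> {a<..<b}"
proof (cases "finite {a<..<b}")
  case True
  have inv: "inv f (f c) = c" for c
    using assms(1) by (simp add: strict_mono_imp_inj_on)
  have *: "\<exists>c \<in> {a<..<b}. z = f c" if "z \<in> D \<inter> {f a<..<f b}" for z
    using cover_preserving_finite_gap[OF assms(1,2) True] that by auto
  have "strict_mono_on (D \<inter> {f a<..<f b}) (inv f)"
    by (rule strict_mono_onI) (metis * inv assms(1) strict_mono_less)
  moreover have "inv f ` (D \<inter> {f a<..<f b}) \<subseteq> {a<..<b}"
    using * inv by (metis image_subsetI)
  ultimately show ?thesis by blast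
next
  case False
  then show ?thesis using ex_strict_mono_on_finite assms(3) by blast
qed

text \<open>Parameters are added in increasing order, so each step extends \<open>g\<close> across a
  single new gap; the bound on \<open>D\<close> records how far the construction has come. Adjoining
  \<open>bot\<close> supplies a starting point and makes the maximum exist.\<close>

lemma cover_preserving_pullback:
  fixes f :: "'a::{linorder,order_bot} \<Rightarrow> 'b::{linorder,order_bot}"
  assumes f: "strict_mono f" "cover_preserving f" "f bot = bot" and D: "finite D" and S: "finite S"
  shows "\<exists>g. strict_mono_on (D \<inter> {..f (Max (insert bot S))} \<union> f ` insert bot S) g
    \<and> (\<forall>a \<in> insert bot S. g (f a) = a)"
  using S
proof (induction S rule: finite_linorder_max_induct)
  case empty
  have "strict_mono_on (D \<inter> {..f (Max {bot})} \<union> f ` {bot}) (\<lambda>_. bot :: 'a)"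
    using f(3) by (auto simp: strict_mono_on_def bot_unique)
  then show ?case by auto
next
  case (insert b A)
  show ?case
  proof (cases "b = bot")
    case True
    then show ?thesis using insert.IH by simp
  next
    case False
    define a where "a = Max (insert bot A)"
    have a: "a \<in> insert bot A" "\<And>c. c \<in> insert bot A \<Longrightarrow> c \<le> a"
      using insert.hyps(1) Max_in[of "insert bot A"] by (auto simp: a_def simp del: Max_insert)
    have "a < b" using a(1) insert.hyps(2) False by (auto simp: bot.not_eq_extremum)
    then have "f a < f b" using f(1) by (simp add: strict_mono_less)
    have Max: "Max (insert bot (insert b A)) = b"
      using a(2) \<open>a < b\<close> insert.hyps(1) by (intro Max_eqI) (auto intro: order_trans less_imp_le)
    obtain g where g: "strict_mono_on (D \<inter> {..f a} \<union> f ` insert bot A) g"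
      "\<And>c. c \<in> insert bot A \<Longrightarrow> g (f c) = c"
      using insert.IH unfolding a_def by blast
    obtain h where h: "strict_mono_on (D \<inter> {f a<..<f b}) h" "h ` (D \<inter> {f a<..<f b}) \<subseteq> {a<..<b}"
      using cover_preserving_gap_pullback[OF f(1,2) D] by blast
    \<comment> \<open>Glue the old map below \<open>f a\<close>, the gap map strictly between, and
      the new value at \<open>f b\<close>.\<close>
    define k where "k z = (if z \<le> f a then g z else if z < f b then h z else b)" for z
    define E where "E = D \<inter> {..f a} \<union> f ` insert bot A"
    define G where "G = D \<inter> {f a<..<f b}"
    have fle: "f c \<le> f a" if "c \<in> insert bot A" for c
      using a(2)[OF that] f(1) by (simp add: strict_mono_less_eq)
    have E: "z \<le> f a" "k z = g z" "k z \<le> a" if "z \<in> E" for z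
    proof -
      show "z \<le> f a" using that fle by (auto simp: E_def)
      then show "k z = g z" by (simp add: k_def)
      have "g z \<le> g (f a)"
        using g(1) that a(1) \<open>z \<le> f a\<close> unfolding E_def
        by (metis UnI2 imageI strict_mono_on_leD)
      then show "k z \<le> a" using \<open>k z = g z\<close> g(2)[OF a(1)] by simp
    qed
    have G: "f a < z" "z < f b" "k z = h z" "a < k z" "k z < b" if "z \<in> G" for z
      using that h(2) by (auto simp: G_def k_def image_subset_iff)
    have kb: "k (f b) = b" using \<open>f a < f b\<close> by (metis k_def less_irrefl not_le)
    have cover: "D \<inter> {..f b} \<union> f ` insert bot (insert b A) \<subseteq> E \<union> G \<union> {f b}"
      by (auto simp: E_def G_def not_le)
    have "strict_mono_on (E \<union> G \<union> {f b}) k"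
    proof (rule strict_mono_onI)
      fix x y assume xy: "x \<in> E \<union> G \<union> {f b}" "y \<in> E \<union> G \<union> {f b}" "x < y"
      \<comment> \<open>The other combinations contradict \<open>x < y\<close>, because
        \<open>E\<close> lies below \<open>G\<close> and \<open>G\<close> below
        \<open>f b\<close>.\<close>
      consider "x \<in> E" "y \<in> E" | "x \<in> E" "y \<in> G" | "x \<in> E" "y = f b" | "x \<in> G" "y \<in> G"
        | "x \<in> G" "y = f b"
        using xy E(1) G(1,2) \<open>f a < f b\<close> by fastforce
      then show "k x < k y"
      proof cases
        case 1
        then show ?thesis using g(1) xy(3) E(2) unfolding E_def[symmetric]
          by (simp add: strict_mono_onD)
      next
        case 2
        then show ?thesis using E(3) G(4) by (meson le_less_trans)
      next
        case 3
        then show ?thesis using E(3) kb \<open>a < b\<close> by (metis le_less_trans)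
      next
        case 4
        then show ?thesis using h(1) xy(3) G(3) unfolding G_def[symmetric]
          by (simp add: strict_mono_onD)
      next
        case 5
        then show ?thesis using G(5) kb by simp
      qed
    qed
    then have "strict_mono_on (D \<inter> {..f b} \<union> f ` insert bot (insert b A)) k"
      using cover monotone_on_subset by blast
    moreover have "k (f c) = c" if "c \<in> insert bot (insert b A)" for c
      using that kb g(2) fle by (auto simp: k_def)
    ultimately show ?thesis unfolding Max by blast
  qed
qed

section \<open>The two implications\<close>

lemma cover_preserving_imp_forall_embedding:
  fixes f :: "'a::linear_heyting_algebra \<Rightarrow> 'b::linear_heyting_algebra"
  assumes f: "heyting_embedding f" and cov: "cover_preserving f"
  shows "forall_embedding f"
  unfolding forall_embedding_def
proof (intro conjI allI impI f)
  fix m n s t and as :: "'a list" and xs :: "'b list"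
  assume eq: "equation_in m n s t" and as: "length as = n" and xs: "length xs = m"
    and sat: "\<forall>xs :: 'a list. length xs = m \<longrightarrow> satisfies_eq s t xs as"
  have f': "f bot = bot" "f top = top"
    using f by (auto simp: heyting_embedding_def heyting_hom_def)
  \<comment> \<open>With \<open>top\<close> among the parameters, the initial segment covered by the
    pullback is everything, and \<open>g\<close> fixes \<open>top\<close>.\<close>
  define S where "S = insert top (set as)"
  have Max: "Max (insert bot S) = top"
    by (intro Max_eqI) (auto simp: S_def)
  have UNIV: "{..f top} = UNIV" by (simp add: f'(2) set_eq_iff)
  obtain g where g: "strict_mono_on (set xs \<union> f ` insert bot S) g"
    and gf: "\<And>a. a \<in> insert bot S \<Longrightarrow> g (f a) = a"
    using cover_preserving_pullback[OF heyting_embedding_strict_mono[OF f] cov f'(1),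
        of "set xs" S] unfolding Max UNIV Int_UNIV_right
    by (metis S_def List.finite_set finite_insert)
  define C where "C = set xs \<union> f ` insert bot S"
  have C: "bot \<in> C" "top \<in> C" "g bot = bot" "g top = top"
    using gf[of bot] gf[of top] f' by (auto simp: C_def S_def intro: rev_image_eqI)
  define e where "e = case_sum ((!) xs) ((!) (map f as))"
  \<comment> \<open>The pulled-back assignment: \<open>g\<close> moves the universally quantified
    values and returns each parameter to its original.\<close>
  define e' where "e' = case_sum ((!) (map g xs)) ((!) as)"
  have e: "e v \<in> C \<and> e' v = g (e v)" if "v \<in> {..<m} <+> {..<n}" for v
  proof (cases v)
    case (Inl i)
    with that xs show ?thesis by (auto simp: e_def e'_def C_def)
  next
    case (Inr j)
    with that as have "as ! j \<in> insert bot S" "e v = f (as ! j)" "e' v = as ! j"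
      by (auto simp: e_def e'_def S_def)
    then show ?thesis using gf unfolding C_def by (metis UnI2 imageI)
  qed
  have eval: "hterm_eval e u \<in> C \<and> hterm_eval e' u = g (hterm_eval e u)"
    if "set_hterm u \<subseteq> {..<m} <+> {..<n}" for u
    by (rule hterm_eval_strict_mono_on[OF g[folded C_def] C]) (use e that in blast)
  have "hterm_eval e' s = hterm_eval e' t"
    using sat xs by (simp add: satisfies_eq_def e'_def)
  \<comment> \<open>The two sides under \<open>e'\<close> are the \<open>g\<close>-images of those
    under \<open>e\<close>, and \<open>g\<close> is injective on \<open>C\<close>.\<close>
  then have "hterm_eval e s = hterm_eval e t"
    using eval eq strict_mono_on_imp_inj_on[OF g[folded C_def]]
    unfolding equation_in_def by (metis inj_on_def)
  then show "satisfies_eq s t xs (map f as)"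
    by (simp add: satisfies_eq_def e_def)
qed

lemma forall_embedding_imp_cover_preserving:
  fixes f :: "'a::linear_heyting_algebra \<Rightarrow> 'b::linear_heyting_algebra"
  assumes f: "forall_embedding f"
  shows "cover_preserving f"
  unfolding cover_preserving_def
proof (intro allI impI)
  fix a b :: 'a
  assume ab: "a \<prec> b"
  \<comment> \<open>On a chain, this disjunction equals \<open>top\<close> exactly when
    \<open>x\<close> is not strictly between the two parameters.\<close>
  define s :: "(nat + nat) hterm" where
    "s = HOr (HImp (HVar (Inl 0)) (HVar (Inr 0))) (HImp (HVar (Inr 1)) (HVar (Inl 0)))"
  \<comment> \<open>The type \<open>'c\<close> is left generic because the equivalence is used in
    both algebras.\<close>
  have sat: "satisfies_eq s HTop [x] [c, d] \<longleftrightarrow> x \<le> c \<or> d \<le> x"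
    for x c d :: "'c::linear_heyting_algebra"
    by (simp add: satisfies_eq_def s_def sup_eq_top_linear heyting_imp_eq_top)
  have "satisfies_eq s HTop xs [a, b]" if xs: "length xs = 1" for xs
  proof -
    obtain x where "xs = [x]" using xs by (auto simp: length_Suc_conv)
    then show ?thesis using ab sat[of x a b] by (metis covered_by_def not_le)
  qed
  moreover have "equation_in 1 2 s HTop"
    by (auto simp: equation_in_def s_def)
  ultimately have "satisfies_eq s HTop [x] (map f [a, b])" for x
    using f unfolding forall_embedding_def
    by (metis (no_types, lifting) length_Cons list.size(3) One_nat_def Suc_1)
  then have "x \<le> f a \<or> f b \<le> x" for x by (simp add: sat)
  moreover have "f a < f b"
    using ab f heyting_embedding_strict_mono[of f]
    unfolding covered_by_def forall_embedding_def by (meson strict_monoD)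
  ultimately show "f a \<prec> f b" by (metis covered_by_def not_le)
qed

theorem theorem6p8:
  fixes f :: "'a::linear_heyting_algebra \<Rightarrow> 'b::linear_heyting_algebra"
  assumes "heyting_embedding f"
  shows "forall_embedding f \<longleftrightarrow> cover_preserving f"
  using assms cover_preserving_imp_forall_embedding forall_embedding_imp_cover_preserving by blast

end
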